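(* For any $k\ge 2$ there exists $n_0=n_0(k)$ such that if $n\ge n_0$ and $\mathcal{F}\subseteq\binom{[n]}{k}$ is a family with $\ell(\mathcal{F})\ge 3$ and $K(n,k)[\mathcal{F}]$ is $C_6$-free, then $$|\mathcal{F}|<\binom{n-1}{k-1}-\binom{n-2k-1}{k-1}+10^6\left(\binom{n-1}{k-1}-\binom{n-2k-1}{k-1}\right)^{3/4}.$$
   Context: $[n]=\{1,\dots,n\}$, $\binom{[n]}{k}$ is the set of $k$-subsets of $[n]$. The Kneser graph $K(n,k)$ has vertex set $\binom{[n]}{k}$, two vertices adjacent iff disjoint; $K(n,k)[\mathcal{F}]$ is the induced subgraph on $\mathcal{F}$. $C_6$-free means containing no (not necessarily induced) cycle of length 6. $\ell(\mathcal{F})$ is the minimum number of sets one must remove from $\mathcal{F}$ so that the remaining family is intersecting. *)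

theory Defs
  imports Complex_Main "HOL-Library.Ramsey" "Graph_Theory.Graph_Theory"
begin

(* As usual in Graph_Theory, an undirected graph is a symmetric digraph. There are no
   loops for k >= 1; the only loop is the one at the empty set for k = 0. *)
definition kneser :: "nat \<Rightarrow> nat \<Rightarrow> nat set pair_pre_digraph" where
  "kneser n k = \<lparr> pverts = nsets {1..n} k,
     parcs = {(A, B). A \<in> nsets {1..n} k \<and> B \<in> nsets {1..n} k \<and> A \<inter> B = {}} \<rparr>"

lemma pair_graph_kneser:
  assumes "k \<ge> 1"
  shows "pair_graph (kneser n k)"
proof -
  let ?V = "nsets {1..n} k"
  have fin: "finite ?V"
    by (rule finite_imp_finite_nsets) simp
  have arc: "fst e \<in> pverts (kneser n k)" "snd e \<in> pverts (kneser n k)" "fst e \<noteq> snd e"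
    if "e \<in> parcs (kneser n k)" for e
  proof -
    from that obtain A B where e: "e = (A, B)" "A \<in> ?V" "B \<in> ?V" "A \<inter> B = {}"
      unfolding kneser_def by auto
    then show "fst e \<in> pverts (kneser n k)" "snd e \<in> pverts (kneser n k)"
      unfolding kneser_def by simp_all
    show "fst e \<noteq> snd e"
      using e assms unfolding nsets_def by force
  qed
  have verts: "finite (pverts (kneser n k))"
    using fin unfolding kneser_def by simp
  have "parcs (kneser n k) \<subseteq> ?V \<times> ?V"
    unfolding kneser_def by auto
  then have arcs: "finite (parcs (kneser n k))"
    using fin by (meson finite_SigmaI finite_subset)
  have sym: "symmetric (with_proj (kneser n k))"
    unfolding kneser_def symmetric_def by (auto intro!: symI)
  show ?thesis
    by (intro pair_graph.intro pair_digraph.intro pair_pseudo_graph.intro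
      pair_fin_digraph.intro pair_sym_digraph.intro pair_loopfree_digraph.intro
      pair_wf_digraph.intro pair_fin_digraph_axioms.intro pair_sym_digraph_axioms.intro
      pair_loopfree_digraph_axioms.intro arc verts arcs sym)
qed

(* A cycle is a non-empty closed directed walk whose only repeated vertex is the common
   endpoint. In a symmetric digraph those with six arcs are exactly the (not necessarily induced) copies of C_6. *)
definition C6_free :: "('a, 'b) pre_digraph \<Rightarrow> bool" where
  "C6_free G \<longleftrightarrow> \<not> (\<exists>p. pre_digraph.cycle G p \<and> length p = 6)"

definition intersecting :: "'a set set \<Rightarrow> bool" where
  "intersecting F \<longleftrightarrow> (\<forall>A\<in>F. \<forall>B\<in>F. A \<inter> B \<noteq> {})"

(* The function l of the text. It is only meaningful for finite F: an infinite S would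
   have card S = 0. For finite F the minimum exists, since S = F is admissible. *)
definition ell :: "'a set set \<Rightarrow> nat" where
  "ell F = (LEAST m. \<exists>S\<subseteq>F. card S = m \<and> intersecting (F - S))"

(* Natural subtraction truncates n - 2 * k - 1 only for n < 2k + 1, hence not for large n. *)
definition main_term :: "nat \<Rightarrow> nat \<Rightarrow> real" where
  "main_term n k =
     real ((n - 1) choose (k - 1)) - real ((n - 2 * k - 1) choose (k - 1))"

end

theory Submission
  imports Defs
begin

text \<open>Branching on blocking sets of size at most \<open>5 * k\<close> covers the family by boundedly many robust
  kernels: sets \<open>T\<close> such that members of the family above \<open>T\<close> can be chosen to avoid any
  \<open>5 * k\<close> elements outside \<open>T\<close>. By \<open>C\<^sub>6\<close>-freeness the kernels of size less than \<open>k\<close> pairwise intersect.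
  If they all contain one element \<open>x\<close>, then all but boundedly many members of the family contain \<open>x\<close>.
  As \<open>ell F \<ge> 3\<close>, there are three members outside this star, and some two of them, \<open>A\<close> and \<open>B\<close>,
  are such that all but two members of the star meet \<open>A \<union> B\<close>, whence the main term.
  Otherwise there are at most \<open>2 * k - 1\<close> kernels of size \<open>2\<close> and no smaller ones, so the family
  has about \<open>(2 * k - 1) * (n choose (k - 2))\<close> members, whereas the main term is about
  \<open>2 * k * (n choose (k - 2))\<close>.\<close>

section \<open>Hexagons in the Kneser graph and elementary counting\<close>

lemma C6_freeD:
  assumes free: "C6_free (with_proj (kneser n k) \<restriction> F)" and F: "F \<subseteq> nsets {1..n} k"
    and mem: "{a, b, c, d, e, f} \<subseteq> F" and dist: "distinct [a, b, c, d, e, f]"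
    and disj: "a \<inter> b = {}" "b \<inter> c = {}" "c \<inter> d = {}" "d \<inter> e = {}" "e \<inter> f = {}" "f \<inter> a = {}"
  shows False
proof -
  let ?G = "with_proj (kneser n k) \<restriction> F"
  let ?p = "[(a, b), (b, c), (c, d), (d, e), (e, f), (f, a)]"
  have m: "a \<in> F" "b \<in> F" "c \<in> F" "d \<in> F" "e \<in> F" "f \<in> F"
    using mem by auto
  have ends: "tail ?G = fst" "head ?G = snd"
    by (simp_all add: induce_subgraph_def)
  have verts: "verts ?G = F"
    by (simp add: induce_subgraph_def)
  have arc: "(X, Y) \<in> arcs ?G" if "X \<in> F" "Y \<in> F" "X \<inter> Y = {}" for X Y
    using that F by (auto simp: kneser_def induce_subgraph_def)
  have "set ?p \<subseteq> arcs ?G"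
    using arc[OF m(1,2) disj(1)] arc[OF m(2,3) disj(2)] arc[OF m(3,4) disj(3)]
      arc[OF m(4,5) disj(4)] arc[OF m(5,6) disj(5)] arc[OF m(6,1) disj(6)] by simp
  then have "pre_digraph.awalk ?G a ?p a"
    unfolding pre_digraph.awalk_def verts
    by (simp only: pre_digraph.cas.simps ends fst_conv snd_conv m simp_thms)
  \<comment> \<open>The vertex list names \<open>a\<close> at both ends; without its first entry it
    is a rotation of the six vertices, so \<open>dist\<close> carries over.\<close>
  moreover have "pre_digraph.awalk_verts ?G a ?p = a # rotate1 [a, b, c, d, e, f]"
    by (simp only: pre_digraph.awalk_verts.simps ends fst_conv snd_conv rotate1.simps append.simps)
  then have "distinct (tl (pre_digraph.awalk_verts ?G a ?p))"
    using dist by (simp only: list.sel distinct1_rotate)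
  ultimately have "pre_digraph.cycle ?G ?p"
    unfolding pre_digraph.cycle_def by blast
  then have "\<exists>p. pre_digraph.cycle ?G p \<and> length p = 6"
    by (intro exI[of _ ?p]) simp
  then show False
    using free unfolding C6_free_def by blast
qed

lemma exists_in_diff_of_card_less:
  assumes "finite W" "card W < card S"
  shows "\<exists>x\<in>S. x \<notin> W"
proof (rule ccontr)
  assume "\<not> ?thesis"
  then have "S \<subseteq> W" by blast
  then show False using assms card_mono[of W S] by simp
qed

lemma distinct_representatives_of_card_ge_3:
  assumes "card X \<ge> 3" "card Y \<ge> 3" "card Z \<ge> 3"
  obtains x y z where "x \<in> X" "y \<in> Y" "z \<in> Z" "x \<noteq> y" "x \<noteq> z" "y \<noteq> z"
proof -
  obtain x where x: "x \<in> X"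
    using exists_in_diff_of_card_less[of "{}" X] assms by auto
  obtain y where y: "y \<in> Y" "y \<notin> {x}"
    using exists_in_diff_of_card_less[of "{x}" Y] assms by auto
  have "card {x, y} < card Z"
    using assms(3) card_insert_le_m1[of 2 "{y}" x] by simp
  then obtain z where "z \<in> Z" "z \<notin> {x, y}"
    using exists_in_diff_of_card_less[of "{x, y}" Z] by auto
  then show ?thesis using that x y by auto
qed

text \<open>Removing \<open>T\<close> is a bijection onto the subsets of \<open>V - T - U\<close> of
  size \<open>k - card T\<close>.\<close>

lemma card_nsets_containing_avoiding:
  assumes "finite V" "T \<subseteq> V" "U \<subseteq> V" "T \<inter> U = {}" "card T \<le> k"
  shows "card {A \<in> nsets V k. T \<subseteq> A \<and> A \<inter> U = {}} = (card V - card T - card U) choose (k - card T)"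
proof -
  have fin: "finite T" "finite U"
    using assms by (auto intro: finite_subset)
  have "bij_betw (\<lambda>B. T \<union> B) (nsets (V - T - U) (k - card T)) {A \<in> nsets V k. T \<subseteq> A \<and> A \<inter> U = {}}"
  proof (rule bij_betw_byWitness[where f' = "\<lambda>A. A - T"])
    show "(\<union>) T ` nsets (V - T - U) (k - card T) \<subseteq> {A \<in> nsets V k. T \<subseteq> A \<and> A \<inter> U = {}}"
    proof clarify
      fix B assume B: "B \<in> nsets (V - T - U) (k - card T)"
      then have "card (T \<union> B) = card T + card B"
        using fin by (intro card_Un_disjoint) (auto simp: nsets_def)
      then show "T \<union> B \<in> nsets V k \<and> T \<subseteq> T \<union> B \<and> (T \<union> B) \<inter> U = {}"
        using B assms fin by (auto simp: nsets_def)
    qed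
    show "(\<lambda>A. A - T) ` {A \<in> nsets V k. T \<subseteq> A \<and> A \<inter> U = {}} \<subseteq> nsets (V - T - U) (k - card T)"
      using fin by (auto simp: nsets_def card_Diff_subset)
  qed (auto simp: nsets_def)
  then have "card {A \<in> nsets V k. T \<subseteq> A \<and> A \<inter> U = {}} = card (nsets (V - T - U) (k - card T))"
    by (rule bij_betw_same_card[symmetric])
  also have "card (V - T - U) = card V - card T - card U"
    using assms fin by (subst card_Diff_subset) (auto simp: card_Diff_subset)
  then have "card (nsets (V - T - U) (k - card T)) = (card V - card T - card U) choose (k - card T)"
    by simp
  finally show ?thesis .
qed

section \<open>Stars\<close>

text \<open>Subtract from the full star the sets avoiding \<open>U\<close>; as
  \<open>card U \<le> 2 * k\<close>, there are at least
  \<open>(n - 2 * k - 1) choose (k - 1)\<close> of them. In the application \<open>U\<close> is the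
  union of two members outside the star.\<close>

lemma card_star_meeting_le:
  assumes "x \<in> {1..n}" "U \<subseteq> {1..n}" "x \<notin> U" "card U \<le> 2 * k" "k \<ge> 1"
  shows "real (card {A \<in> nsets {1..n} k. x \<in> A \<and> A \<inter> U \<noteq> {}}) \<le> main_term n k"
proof -
  let ?N = "nsets {1..n} k"
  have "finite ?N"
    by (simp add: finite_imp_finite_nsets)
  then have fin: "finite {A \<in> ?N. P A}" for P
    by simp
  have all: "card {A \<in> ?N. x \<in> A} = (n - 1) choose (k - 1)"
    using card_nsets_containing_avoiding[of "{1..n}" "{x}" "{}" k] assms by simp
  have avoid: "card {A \<in> ?N. x \<in> A \<and> A \<inter> U = {}} = (n - 1 - card U) choose (k - 1)"
    using card_nsets_containing_avoiding[of "{1..n}" "{x}" U k] assms by simp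
  have "card {A \<in> ?N. x \<in> A} =
      card {A \<in> ?N. x \<in> A \<and> A \<inter> U \<noteq> {}} + card {A \<in> ?N. x \<in> A \<and> A \<inter> U = {}}"
    by (subst card_Un_disjoint[symmetric]) (use fin in \<open>auto intro!: arg_cong[where f = card]\<close>)
  moreover have "(n - 2 * k - 1) choose (k - 1) \<le> (n - 1 - card U) choose (k - 1)"
    using assms by (intro binomial_right_mono) simp
  ultimately show ?thesis
    unfolding main_term_def using all avoid by linarith
qed

text \<open>Three members of the family outside the star cannot pairwise have three common neighbours
  in the star: the alternating sequence would be a hexagon.\<close>

lemma card_star_le:
  assumes free: "C6_free (with_proj (kneser n k) \<restriction> F)" and F: "F \<subseteq> nsets {1..n} k"
    and ell: "ell F \<ge> 3" and x: "x \<in> {1..n}" and k: "k \<ge> 1"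
  shows "real (card {A \<in> F. x \<in> A}) \<le> main_term n k + 2"
proof -
  have finN: "finite (nsets {1..n} k)"
    by (simp add: finite_imp_finite_nsets)
  then have finF: "finite F"
    using F finite_subset by blast
  let ?S = "{A \<in> F. x \<notin> A}"
  have "F - ?S = {A \<in> F. x \<in> A}" by auto
  then have "intersecting (F - ?S)"
    unfolding intersecting_def by auto
  \<comment> \<open>Deleting \<open>?S\<close> leaves only sets through \<open>x\<close>, so
    \<open>card ?S\<close> competes in the minimum that defines \<open>ell F\<close>.\<close>
  then have "ell F \<le> card ?S"
    unfolding ell_def by (intro Least_le exI[of _ ?S]) auto
  then have S3: "card ?S \<ge> 3" using ell by simp
  obtain A B C where ABC: "A \<in> ?S" "B \<in> ?S" "C \<in> ?S" "A \<noteq> B" "A \<noteq> C" "B \<noteq> C"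
    using distinct_representatives_of_card_ge_3[OF S3 S3 S3] by blast
  define N where "N = (\<lambda>P Q. {D \<in> F. x \<in> D \<and> D \<inter> (P \<union> Q) = {}})"
  \<comment> \<open>If \<open>P\<close> and \<open>Q\<close> have at most two common neighbours in
    the star, all its other sets meet \<open>P \<union> Q\<close>, which has at most
    \<open>2 * k\<close> elements.\<close>
  have bound: ?thesis if PQ: "P \<in> ?S" "Q \<in> ?S" "card (N P Q) \<le> 2" for P Q
  proof -
    let ?M = "{A \<in> nsets {1..n} k. x \<in> A \<and> A \<inter> (P \<union> Q) \<noteq> {}}"
    have P: "P \<subseteq> {1..n}" "Q \<subseteq> {1..n}" "card P = k" "card Q = k"
      using PQ F by (auto simp: nsets_def)
    have "card (P \<union> Q) \<le> 2 * k"
      using card_Un_le[of P Q] P by simp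
    then have M: "real (card ?M) \<le> main_term n k"
      using P PQ x k by (intro card_star_meeting_le) auto
    have "{A \<in> F. x \<in> A} \<subseteq> ?M \<union> N P Q"
      using F by (auto simp: N_def)
    then have "card {A \<in> F. x \<in> A} \<le> card (?M \<union> N P Q)"
      using finN finF by (intro card_mono) (auto simp: N_def)
    also have "\<dots> \<le> card ?M + card (N P Q)"
      by (rule card_Un_le)
    finally show ?thesis using M PQ by linarith
  qed
  show ?thesis
  proof (rule ccontr)
    assume "\<not> ?thesis"
    then have "card (N A B) \<ge> 3" "card (N B C) \<ge> 3" "card (N C A) \<ge> 3"
      using bound[of A B] bound[of B C] bound[of C A] ABC by linarith+
    then obtain D1 D2 D3 where D: "D1 \<in> N A B" "D2 \<in> N B C" "D3 \<in> N C A"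
      "D1 \<noteq> D2" "D1 \<noteq> D3" "D2 \<noteq> D3"
      by (rule distinct_representatives_of_card_ge_3)
    \<comment> \<open>\<open>D1\<close>, \<open>D2\<close>, \<open>D3\<close> contain
      \<open>x\<close>, whereas \<open>A\<close>, \<open>B\<close>, \<open>C\<close> do not.\<close>
    have "distinct [A, D1, B, D2, C, D3]"
      using ABC D by (auto simp: N_def)
    moreover have "{A, D1, B, D2, C, D3} \<subseteq> F"
      using ABC D by (simp add: N_def)
    moreover have "A \<inter> D1 = {}" "D1 \<inter> B = {}" "B \<inter> D2 = {}" "D2 \<inter> C = {}" "C \<inter> D3 = {}" "D3 \<inter> A = {}"
      using D(1-3) unfolding N_def by blast+
    ultimately show False
      using C6_freeD[OF free F] by metis
  qed
qed

section \<open>Robust kernels\<close>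

text \<open>A robust set acts like the core of a sunflower with many petals. Every member of
  \<open>F\<close> is itself robust, which is why later statements single out kernels of size less
  than \<open>k\<close>.\<close>

definition robust :: "nat \<Rightarrow> 'a set set \<Rightarrow> 'a set \<Rightarrow> bool" where
  "robust w F T \<longleftrightarrow>
     (\<forall>W. finite W \<and> card W \<le> w \<and> W \<inter> T = {} \<longrightarrow> (\<exists>A\<in>F. T \<subseteq> A \<and> A \<inter> W = {}))"

lemma robustD:
  assumes "robust w F T" "finite W" "card W \<le> w" "W \<inter> T = {}"
  obtains A where "A \<in> F" "T \<subseteq> A" "A \<inter> W = {}"
  using assms unfolding robust_def by blast

lemma robust_subset_member:
  assumes "robust w F T"
  obtains A where "A \<in> F" "T \<subseteq> A"
  using robustD[OF assms, of "{}"] by auto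

text \<open>Greedy choice: each new member avoids \<open>W\<close> and the parts of the earlier ones
  outside \<open>T\<close>, so at most \<open>card W + 2 * k\<close> elements are ever
  forbidden.\<close>

lemma robust_three:
  assumes T: "robust w F T" "card T < k" and F: "\<And>A. A \<in> F \<Longrightarrow> finite A \<and> card A = k"
    and W: "finite W" "W \<inter> T = {}" "card W + 2 * k \<le> w"
  obtains A1 A2 A3 where "{A1, A2, A3} \<subseteq> F" "A1 \<noteq> A2" "A1 \<noteq> A3" "A2 \<noteq> A3"
    "(A1 \<union> A2 \<union> A3) \<inter> W = {}" "T \<subseteq> A1" "T \<subseteq> A2" "T \<subseteq> A3"
proof -
  \<comment> \<open>As \<open>card T < k\<close>, the set \<open>B - T\<close> is nonempty, so a set
    avoiding it differs from \<open>B\<close>.\<close>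
  have new: "B \<noteq> A" if "B \<in> F" "T \<subseteq> B" "A \<inter> (B - T) = {}" for A B
  proof -
    have "T \<noteq> B" using F[OF that(1)] T(2) by auto
    then show ?thesis using that by blast
  qed
  have card_diff: "card (A - T) \<le> k" if "A \<in> F" for A
    using F[OF that] card_Diff_subset_Int card_mono[of A "A - T"] by auto
  obtain A1 where A1: "A1 \<in> F" "T \<subseteq> A1" "A1 \<inter> W = {}"
    using robustD[OF T(1), of W] W by auto
  have "card (W \<union> (A1 - T)) \<le> w"
    using card_Un_le[of W "A1 - T"] card_diff[OF A1(1)] W by linarith
  then obtain A2 where A2: "A2 \<in> F" "T \<subseteq> A2" "A2 \<inter> (W \<union> (A1 - T)) = {}"
    using robustD[OF T(1), of "W \<union> (A1 - T)"] W F[OF A1(1)] by blast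
  have "card (W \<union> (A1 - T) \<union> (A2 - T)) \<le> w"
    using card_Un_le[of W "A1 - T"] card_Un_le[of "W \<union> (A1 - T)" "A2 - T"]
      card_diff[OF A1(1)] card_diff[OF A2(1)] W by linarith
  then obtain A3 where A3: "A3 \<in> F" "T \<subseteq> A3" "A3 \<inter> (W \<union> (A1 - T) \<union> (A2 - T)) = {}"
    using robustD[OF T(1), of "W \<union> (A1 - T) \<union> (A2 - T)"] W F[OF A1(1)] F[OF A2(1)] by blast
  have "A2 \<inter> (A1 - T) = {}" "A3 \<inter> (A1 - T) = {}" "A3 \<inter> (A2 - T) = {}"
    using A2(3) A3(3) by blast+
  then have "A1 \<noteq> A2" "A1 \<noteq> A3" "A2 \<noteq> A3"
    using new A1(1,2) A2(1,2) by auto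
  moreover have "(A1 \<union> A2 \<union> A3) \<inter> W = {}"
    using A1(3) A2(3) A3(3) by blast
  ultimately show ?thesis
    using that A1(1,2) A2(1,2) A3(1,2) by simp
qed

lemma distinct_interleave: "distinct [a, b, c, x, y, z] \<Longrightarrow> distinct [a, x, b, y, c, z]"
  by auto

text \<open>Two disjoint robust kernels of size less than \<open>k\<close> would span a complete bipartite graph
  with three vertices on each side.\<close>

lemma robust_intersect:
  assumes free: "C6_free (with_proj (kneser n k) \<restriction> F)" and F: "F \<subseteq> nsets {1..n} k"
    and T: "robust (5 * k) F T" "card T < k" and T': "robust (5 * k) F T'" "card T' < k"
  shows "T \<inter> T' \<noteq> {}"
proof
  assume disj: "T \<inter> T' = {}"
  have mem: "finite A \<and> card A = k" if "A \<in> F" for A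
    using that F by (auto simp: nsets_def)
  have "finite T'"
    using robust_subset_member[OF T'(1)] mem finite_subset by metis
  moreover have "card T' + 2 * k \<le> 5 * k" "T' \<inter> T = {}"
    using T' disj by auto
  ultimately obtain A1 A2 A3 where A: "{A1, A2, A3} \<subseteq> F" "A1 \<noteq> A2" "A1 \<noteq> A3" "A2 \<noteq> A3"
    "(A1 \<union> A2 \<union> A3) \<inter> T' = {}"
    using robust_three[OF T mem] by metis
  \<comment> \<open>The origin of \<open>5 * k\<close>: the second choice has to avoid these at most
    \<open>3 * k\<close> elements, and \<open>robust_three\<close> needs \<open>2 * k\<close> more.
    Since the \<open>A\<close>s miss \<open>T'\<close>, their union may be avoided by members above
    \<open>T'\<close>.\<close>
  have "card (A1 \<union> A2 \<union> A3) \<le> card A1 + card A2 + card A3"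
    using card_Un_le[of "A1 \<union> A2" A3] card_Un_le[of A1 A2] by linarith
  then have "card (A1 \<union> A2 \<union> A3) + 2 * k \<le> 5 * k" "finite (A1 \<union> A2 \<union> A3)"
    using A(1) mem by auto
  then obtain B1 B2 B3 where B: "{B1, B2, B3} \<subseteq> F" "B1 \<noteq> B2" "B1 \<noteq> B3" "B2 \<noteq> B3"
    "(B1 \<union> B2 \<union> B3) \<inter> (A1 \<union> A2 \<union> A3) = {}"
    using robust_three[OF T' mem _ A(5)] by metis
  have AB: "X \<inter> Y = {}" "Y \<inter> X = {}" "X \<noteq> Y"
    if "X \<in> {A1, A2, A3}" "Y \<in> {B1, B2, B3}" for X Y
  proof -
    show "X \<inter> Y = {}" "Y \<inter> X = {}" using B(5) that by blast+
    moreover have "X \<noteq> {}" using mem[of X] A(1) T(2) that(1) by auto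
    ultimately show "X \<noteq> Y" by blast
  qed
  have mem6: "{A1, B1, A2, B2, A3, B3} \<subseteq> F"
    using A(1) B(1) by simp
  have "A1 \<noteq> B1" "A1 \<noteq> B2" "A1 \<noteq> B3" "A2 \<noteq> B1" "A2 \<noteq> B2" "A2 \<noteq> B3"
    "A3 \<noteq> B1" "A3 \<noteq> B2" "A3 \<noteq> B3"
    by (rule AB(3); simp)+
  then have "distinct [A1, A2, A3, B1, B2, B3]"
    using A(2-4) B(2-4) by simp
  then have dist6: "distinct [A1, B1, A2, B2, A3, B3]"
    by (rule distinct_interleave)
  have disj1: "A1 \<inter> B1 = {}" "A2 \<inter> B2 = {}" "A3 \<inter> B3 = {}"
    by (rule AB(1); simp)+
  have disj2: "B1 \<inter> A2 = {}" "B2 \<inter> A3 = {}" "B3 \<inter> A1 = {}"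
    by (rule AB(2); simp)+
  show False
    by (rule C6_freeD[OF free F mem6 dist6 disj1(1) disj2(1) disj1(2) disj2(2) disj1(3) disj2(3)])
qed

text \<open>A set that is not robust has a blocking set \<open>W\<close> of size at most \<open>w\<close>, and one
  branches over the elements of \<open>W\<close>; the kernels are the leaves of the branching tree.\<close>

lemma robust_cover_above:
  assumes F: "\<And>A. A \<in> F \<Longrightarrow> finite A \<and> card A = k" and "finite S"
  shows "\<exists>L. finite L \<and> (\<forall>T\<in>L. robust w F T \<and> S \<subseteq> T) \<and> (\<forall>A\<in>F. S \<subseteq> A \<longrightarrow> (\<exists>T\<in>L. T \<subseteq> A)) \<and>
    (\<forall>j. card {T \<in> L. card T = card S + j} \<le> w ^ j)"
  using \<open>finite S\<close>
proof (induction "k - card S" arbitrary: S rule: less_induct)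
  case less
  show ?case
  proof (cases "robust w F S")
    case True
    have count: "card {T \<in> {S}. card T = card S + j} \<le> w ^ j" for j
    proof (cases j)
      case 0
      then have "{T \<in> {S}. card T = card S + j} = {S}" by auto
      then show ?thesis using 0 by simp
    next
      case (Suc i)
      then have "{T \<in> {S}. card T = card S + j} = {}" by auto
      then show ?thesis by (metis card.empty zero_le)
    qed
    show ?thesis
      using True by (intro exI[of _ "{S}"] conjI allI count) simp_all
  next
    case False
    then obtain W where W: "finite W" "card W \<le> w" "W \<inter> S = {}"
      and "\<not> (\<exists>A\<in>F. S \<subseteq> A \<and> A \<inter> W = {})"
      by (auto simp only: robust_def not_all not_imp)
    then have block: "A \<inter> W \<noteq> {}" if "A \<in> F" "S \<subseteq> A" for A
      using that by simp
    show ?thesis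
    proof (cases "\<exists>A\<in>F. S \<subseteq> A")
      case False
      then show ?thesis by (intro exI[of _ "{}"]) auto
    next
      case True
      then obtain A where A: "A \<in> F" "S \<subseteq> A" by blast
      \<comment> \<open>\<open>A\<close> meets \<open>W\<close>, which is disjoint from
        \<open>S\<close>; hence \<open>card S < k\<close>, and adding an element of \<open>W\<close>
        to \<open>S\<close> lowers the measure \<open>k - card S\<close>.\<close>
      then have "S \<subset> A" using block[OF A] W by auto
      then have less_k: "card S < k"
        using F[OF A(1)] psubset_card_mono by metis
      have "\<forall>y\<in>W. \<exists>L. finite L \<and> (\<forall>T\<in>L. robust w F T \<and> insert y S \<subseteq> T) \<and>
        (\<forall>A\<in>F. insert y S \<subseteq> A \<longrightarrow> (\<exists>T\<in>L. T \<subseteq> A)) \<and>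
        (\<forall>j. card {T \<in> L. card T = card (insert y S) + j} \<le> w ^ j)"
      proof
        fix y assume "y \<in> W"
        then have "card (insert y S) = Suc (card S)"
          using W less.prems by (subst card_insert_disjoint) auto
        then have "k - card (insert y S) < k - card S"
          using less_k by simp
        then show "\<exists>L. finite L \<and> (\<forall>T\<in>L. robust w F T \<and> insert y S \<subseteq> T) \<and>
            (\<forall>A\<in>F. insert y S \<subseteq> A \<longrightarrow> (\<exists>T\<in>L. T \<subseteq> A)) \<and>
            (\<forall>j. card {T \<in> L. card T = card (insert y S) + j} \<le> w ^ j)"
          using less.prems by (rule less.hyps[OF _ finite.insertI])
      qed
      from bchoice[OF this] obtain L where L_all: "\<forall>y\<in>W. finite (L y) \<and>
        (\<forall>T\<in>L y. robust w F T \<and> insert y S \<subseteq> T) \<and>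
        (\<forall>A\<in>F. insert y S \<subseteq> A \<longrightarrow> (\<exists>T\<in>L y. T \<subseteq> A)) \<and>
        (\<forall>j. card {T \<in> L y. card T = card (insert y S) + j} \<le> w ^ j)" ..
      have L: "\<And>y. y \<in> W \<Longrightarrow> finite (L y)"
        "\<And>y T. y \<in> W \<Longrightarrow> T \<in> L y \<Longrightarrow> robust w F T \<and> insert y S \<subseteq> T"
        "\<And>y A. y \<in> W \<Longrightarrow> A \<in> F \<Longrightarrow> insert y S \<subseteq> A \<Longrightarrow> \<exists>T\<in>L y. T \<subseteq> A"
        "\<And>y j. y \<in> W \<Longrightarrow> card {T \<in> L y. card T = card (insert y S) + j} \<le> w ^ j"
        using L_all by blast+
      \<comment> \<open>Level \<open>j\<close> over \<open>S\<close> is made of the levels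
        \<open>j - 1\<close> over \<open>insert y S\<close> for at most \<open>w\<close> elements
        \<open>y\<close>. Level \<open>0\<close> is empty, as each kernel found contains some
        \<open>y \<notin> S\<close>.\<close>
      have count: "card {T \<in> (\<Union>y\<in>W. L y). card T = card S + j} \<le> w ^ j" for j
      proof (cases j)
        case 0
        have "card T \<noteq> card S" if "y \<in> W" "T \<in> L y" for y T
        proof -
          have "finite T"
            using L(2)[OF that] F robust_subset_member finite_subset by metis
          moreover have "S \<subset> T" using L(2)[OF that] W that by auto
          ultimately show ?thesis using psubset_card_mono by (metis less_irrefl)
        qed
        then have "{T \<in> (\<Union>y\<in>W. L y). card T = card S + j} = {}"
          using 0 by auto
        then show ?thesis by (metis card.empty zero_le)
      next
        case (Suc i)
        have ins: "card (insert y S) = Suc (card S)" if "y \<in> W" for y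
          using W less.prems that by (subst card_insert_disjoint) auto
        have "{T \<in> (\<Union>y\<in>W. L y). card T = card S + j} =
            (\<Union>y\<in>W. {T \<in> L y. card T = card (insert y S) + i})"
          using ins Suc by auto
        then have "card {T \<in> (\<Union>y\<in>W. L y). card T = card S + j} \<le>
            (\<Sum>y\<in>W. card {T \<in> L y. card T = card (insert y S) + i})"
          by (simp only: card_UN_le[OF W(1)])
        also have "\<dots> \<le> (\<Sum>y\<in>W. w ^ i)"
          by (intro sum_mono L(4))
        also have "\<dots> \<le> w ^ j"
          using W Suc by simp
        finally show ?thesis .
      qed
      have "\<exists>T\<in>(\<Union>y\<in>W. L y). T \<subseteq> A" if A: "A \<in> F" "S \<subseteq> A" for A
      proof -
        obtain y where "y \<in> A" "y \<in> W" using block[OF A] by auto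
        then show ?thesis using L(3)[of y A] A by auto
      qed
      then show ?thesis
        using L(1,2) W(1) by (intro exI[of _ "\<Union>y\<in>W. L y"] conjI allI count) auto
    qed
  qed
qed

lemma robust_cover:
  assumes "\<And>A. A \<in> F \<Longrightarrow> finite A \<and> card A = k"
  shows "\<exists>L. finite L \<and> (\<forall>T\<in>L. robust w F T) \<and> (\<forall>A\<in>F. \<exists>T\<in>L. T \<subseteq> A) \<and>
    (\<forall>j. card {T \<in> L. card T = j} \<le> w ^ j)"
  using robust_cover_above[where F = F and k = k and S = "{}" and w = w, OF assms] by simp

section \<open>Intersecting kernels: a common element or few pairs\<close>

text \<open>Pairwise intersecting edges form a star or a triangle, and a triangle has only three
  edges.\<close>

lemma intersecting_pairs_have_centre:
  assumes "card P \<ge> 4" and two: "\<And>T. T \<in> P \<Longrightarrow> card T = 2"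
    and int: "\<And>T T'. T \<in> P \<Longrightarrow> T' \<in> P \<Longrightarrow> T \<inter> T' \<noteq> {}"
  obtains x where "\<And>T. T \<in> P \<Longrightarrow> x \<in> T"
proof -
  obtain T1 where T1: "T1 \<in> P"
    using assms(1) by (metis card.empty ex_in_conv not_numeral_le_zero)
  obtain T2 where T2: "T2 \<in> P" "T2 \<noteq> T1"
    using exists_in_diff_of_card_less[of "{T1}" P] assms(1) by auto
  obtain x where x: "x \<in> T1" "x \<in> T2"
    using int T1 T2 by blast
  obtain y z where yz: "T1 = {x, y}" "T2 = {x, z}" "x \<noteq> y" "x \<noteq> z" "y \<noteq> z"
  proof -
    obtain y where "T1 = {x, y}" "x \<noteq> y"
      using two[OF T1] x(1) by (auto simp: card_2_iff)
    moreover obtain z where "T2 = {x, z}" "x \<noteq> z"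
      using two[OF T2(1)] x(2) by (auto simp: card_2_iff)
    ultimately show ?thesis using that T2 by blast
  qed
  have other: "T = {y, z}" if "T \<in> P" "x \<notin> T" for T
  proof -
    have "y \<in> T" "z \<in> T"
      using int[OF that(1) T1] int[OF that(1) T2(1)] yz that by auto
    then show ?thesis
      using two[OF that(1)] yz by (auto simp: card_2_iff)
  qed
  \<comment> \<open>A pair outside this list passes through \<open>x\<close> and is disjoint from
    \<open>{y, z}\<close>, which excludes the triangle.\<close>
  have "card {T1, T2, {y, z}} < card P"
    using assms(1) card_insert_le_m1[of 3 "{T2, {y, z}}" T1] card_insert_le_m1[of 2 "{{y, z}}" T2]
    by simp
  then obtain T3 where T3: "T3 \<in> P" "T3 \<notin> {T1, T2, {y, z}}"
    using exists_in_diff_of_card_less[of "{T1, T2, {y, z}}" P] by auto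
  then obtain u where u: "T3 = {x, u}"
    using other[of T3] two[OF T3(1)] by (auto simp: card_2_iff)
  have "x \<in> T" if "T \<in> P" for T
  proof (rule ccontr)
    assume "x \<notin> T"
    then have "T = {y, z}" using other that by simp
    then show False
      using int[OF that T3(1)] u T3 yz by auto
  qed
  then show ?thesis using that by blast
qed

text \<open>Given \<open>2 * k\<close> kernels \<open>{x, y\<^sub>i}\<close>, a kernel avoiding \<open>x\<close> would contain all \<open>y\<^sub>i\<close>.\<close>

lemma kernels_dichotomy:
  assumes k: "k \<ge> 2" and fin: "\<And>T. T \<in> L \<Longrightarrow> finite T" and L: "finite L"
    and int: "\<And>T T'. T \<in> L \<Longrightarrow> T' \<in> L \<Longrightarrow> card T < k \<Longrightarrow> card T' < k \<Longrightarrow> T \<inter> T' \<noteq> {}"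
  shows "(\<exists>x. \<forall>T\<in>L. card T < k \<longrightarrow> x \<in> T) \<or>
    (\<forall>T\<in>L. card T \<ge> 2) \<and> (k \<ge> 3 \<longrightarrow> card {T \<in> L. card T = 2} < 2 * k)"
proof (cases "\<forall>T\<in>L. card T \<ge> 2")
  case False
  then obtain T where T: "T \<in> L" "card T \<le> 1" by force
  \<comment> \<open>The kernel meets itself, so it is a singleton, and its element lies in every
    kernel of size less than \<open>k\<close>.\<close>
  then have "T \<noteq> {}" using int[of T T] k by auto
  then obtain x where "T = {x}"
    using T fin by (metis One_nat_def card_0_eq card_1_singletonE le_Suc_eq le_zero_eq)
  then have "\<forall>T'\<in>L. card T' < k \<longrightarrow> x \<in> T'"
    using int[OF T(1)] T(2) k by fastforce
  then show ?thesis by blast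
next
  case True
  let ?P = "{T \<in> L. card T = 2}"
  \<comment> \<open>Pairs are known to intersect only for \<open>k \<ge> 3\<close>; for
    \<open>k = 2\<close> they have full size.\<close>
  have "\<exists>x. \<forall>T\<in>L. card T < k \<longrightarrow> x \<in> T" if k3: "k \<ge> 3" and P: "card ?P \<ge> 2 * k"
  proof -
    have "card ?P \<ge> 4" using k3 P by linarith
    then obtain x where x: "\<And>T. T \<in> ?P \<Longrightarrow> x \<in> T"
      by (rule intersecting_pairs_have_centre) (use int k3 in auto)
    have "x \<in> T" if T: "T \<in> L" "card T < k" for T
    proof (rule ccontr)
      assume "x \<notin> T"
      have "?P \<subseteq> (\<lambda>y. {x, y}) ` T"
      proof
        fix E assume E: "E \<in> ?P"
        then obtain y where y: "E = {x, y}"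
          using x[OF E] by (auto simp: card_2_iff)
        moreover have "T \<inter> E \<noteq> {}"
          using int[OF T(1) _ T(2)] E k3 by auto
        ultimately show "E \<in> (\<lambda>y. {x, y}) ` T"
          using \<open>x \<notin> T\<close> by auto
      qed
      then have "card ?P \<le> card T"
        using fin[OF T(1)] surj_card_le by blast
      then show False using P T(2) by linarith
    qed
    then show ?thesis by blast
  qed
  then show ?thesis using True by (meson not_le)
qed

section \<open>Binomial estimates\<close>

text \<open>Pascal's rule applied \<open>d\<close> times, each increment being at least the first
  one.\<close>

lemma choose_add_Suc_ge: "(m + d) choose Suc r \<ge> (m choose Suc r) + d * (m choose r)"
proof (induction d)
  case (Suc d)
  have "m choose r \<le> (m + d) choose r" by (simp add: binomial_right_mono)
  then show ?case using Suc by simp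
qed simp

lemma choose_le_power: "n choose r \<le> n ^ r"
  by (cases "r \<le> n") (auto simp: binomial_le_pow binomial_eq_0)

lemma choose_add_Suc_le: "(m + d) choose Suc r \<le> (m choose Suc r) + d * (m + d) ^ r"
proof (induction d)
  case (Suc d)
  have "(m + d) choose r \<le> (m + Suc d) ^ r" "(m + d) ^ r \<le> (m + Suc d) ^ r"
    using choose_le_power[of "m + d" r] power_mono[of "m + d" "m + Suc d" r] by auto
  then have "((m + d) choose r) + d * (m + d) ^ r \<le> (m + Suc d) ^ r + d * (m + Suc d) ^ r"
    by (intro add_mono mult_left_mono) auto
  then show ?case using Suc by simp
qed simp

text \<open>The two binomials are \<open>2 * k\<close> Pascal steps apart. The factor
  \<open>2 * k\<close> has to beat the at most \<open>2 * k - 1\<close> pairs.\<close>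

lemma main_term_ge:
  assumes "k \<ge> 2" "n > 2 * k"
  shows "main_term n k \<ge> 2 * real k * real ((n - 2 * k - 1) choose (k - 2))"
proof -
  have eqs: "n - 2 * k - 1 + 2 * k = n - 1" "k - 1 = Suc (k - 2)"
    using assms by auto
  have "(n - 1) choose (k - 1) \<ge>
      ((n - 2 * k - 1) choose (k - 1)) + 2 * k * ((n - 2 * k - 1) choose (k - 2))"
    using choose_add_Suc_ge[where m = "n - 2 * k - 1" and d = "2 * k" and r = "k - 2"] by (simp only: eqs)
  then have "real ((n - 1) choose (k - 1)) \<ge>
      real ((n - 2 * k - 1) choose (k - 1)) + real (2 * k * ((n - 2 * k - 1) choose (k - 2)))"
    by (metis of_nat_add of_nat_mono)
  then show ?thesis unfolding main_term_def by simp
qed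

text \<open>By \<open>(m / r) ^ r \<le> m choose r\<close> the binomial has order
  \<open>n ^ (k - 2)\<close>, so it outgrows any constant multiple of
  \<open>n ^ (k - 3)\<close>.\<close>

lemma choose_gt_mult_power:
  assumes "k \<ge> 3" "n \<ge> 4 * k + 2" "n > E * (2 * k) ^ (k - 2)"
  shows "(n - 2 * k - 1) choose (k - 2) > E * n ^ (k - 3)"
proof -
  let ?m = "n - 2 * k - 1" and ?r = "k - 2"
  have r: "?r = Suc (k - 3)" using assms by simp
  \<comment> \<open>\<open>n \<ge> 4 * k + 2\<close> gives \<open>2 * ?m \<ge> n\<close>.\<close>
  have "real n / (2 * real k) \<le> real ?m / real ?r"
  proof -
    have "real n * real ?r \<le> real (2 * ?m) * real k"
      using assms by (intro mult_mono) auto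
    then show ?thesis using assms by (simp add: field_simps)
  qed
  then have "(real n / (2 * real k)) ^ ?r \<le> (real ?m / real ?r) ^ ?r"
    by (intro power_mono) auto
  also have "\<dots> \<le> real (?m choose ?r)"
    using assms by (intro binomial_ge_n_over_k_pow_k) simp
  finally have lower: "real n ^ ?r \<le> real (?m choose ?r) * (2 * real k) ^ ?r"
    using assms by (simp add: power_divide field_simps)
  have "real (E * (2 * k) ^ ?r) < real n"
    using assms(3) by (simp only: of_nat_less_iff)
  then have "real (E * (2 * k) ^ ?r) * real n ^ (k - 3) < real n * real n ^ (k - 3)"
    using assms by (intro mult_strict_right_mono) auto
  then have "real E * real n ^ (k - 3) * (2 * real k) ^ ?r < real n ^ ?r"
    unfolding r by (simp add: mult_ac)
  also note lower
  finally have "real E * real n ^ (k - 3) < real (?m choose ?r)"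
    by (rule mult_right_less_imp_less) simp
  then have "real (E * n ^ (k - 3)) < real (?m choose ?r)" by simp
  then show ?thesis by (simp only: of_nat_less_iff)
qed

section \<open>The two cases\<close>

text \<open>A member missing \<open>x\<close> lies above no kernel of size less than
  \<open>k\<close>, so it is itself a kernel of full size.\<close>

lemma card_le_of_star_kernels:
  assumes free: "C6_free (with_proj (kneser n k) \<restriction> F)" and F: "F \<subseteq> nsets {1..n} k"
    and ell: "ell F \<ge> 3" and k: "k \<ge> 1" and n: "n > 2 * k"
    and L: "finite L" "\<And>A. A \<in> F \<Longrightarrow> \<exists>T\<in>L. T \<subseteq> A" "card {T \<in> L. card T = k} \<le> c"
    and x: "\<And>T. T \<in> L \<Longrightarrow> card T < k \<Longrightarrow> x \<in> T"
  shows "real (card F) \<le> main_term n k + 2 + real c"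
proof -
  have finF: "finite F"
    using F finite_subset by (metis finite_atLeastAtMost finite_imp_finite_nsets)
  have mem: "finite A" "card A = k" "A \<subseteq> {1..n}" if "A \<in> F" for A
    using that F by (auto simp: nsets_def)
  have star: "real (card {A \<in> F. x \<in> A}) \<le> main_term n k + 2"
  proof (cases "x \<in> {1..n}")
    case True
    then show ?thesis using card_star_le[OF free F ell _ k] by simp
  next
    \<comment> \<open>\<open>x\<close> is arbitrary if no kernel is smaller than \<open>k\<close>,
      so it may lie outside the ground set; the star is then empty.\<close>
    case False
    then have none: "{A \<in> F. x \<in> A} = {}" using mem(3) by blast
    have "(n - 2 * k - 1) choose (k - 1) \<le> (n - 1) choose (k - 1)"
      by (intro binomial_right_mono) simp
    then have "main_term n k \<ge> 0" unfolding main_term_def by simp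
    then show ?thesis unfolding none by simp
  qed
  have "{A \<in> F. x \<notin> A} \<subseteq> {T \<in> L. card T = k}"
  proof clarify
    fix A assume A: "A \<in> F" "x \<notin> A"
    then obtain T where T: "T \<in> L" "T \<subseteq> A" using L(2) by blast
    then have "\<not> card T < k" using x A by blast
    then have "T = A"
      using T(2) mem[OF A(1)] by (simp add: card_seteq)
    then show "A \<in> L \<and> card A = k" using T mem(2)[OF A(1)] by simp
  qed
  then have "card {A \<in> F. x \<notin> A} \<le> c"
    using L(1,3) card_mono[of "{T \<in> L. card T = k}" "{A \<in> F. x \<notin> A}"] by force
  moreover have "card F = card {A \<in> F. x \<in> A} + card {A \<in> F. x \<notin> A}"
    using finF by (subst card_Un_disjoint[symmetric]) (auto intro!: arg_cong[where f = card])
  ultimately show ?thesis using star by linarith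
qed

text \<open>Union bound over the kernels: at most \<open>(n - 2) choose (k - 2)\<close> members lie
  above a pair, at most \<open>n ^ (k - 3)\<close> above a larger kernel.\<close>

lemma card_le_of_few_pairs:
  assumes F: "F \<subseteq> nsets {1..n} k" and k: "k \<ge> 3" and n: "n > 2 * k"
    and L: "finite L" "\<And>T. T \<in> L \<Longrightarrow> \<exists>A\<in>F. T \<subseteq> A" "\<And>A. A \<in> F \<Longrightarrow> \<exists>T\<in>L. T \<subseteq> A"
    and two: "\<And>T. T \<in> L \<Longrightarrow> card T \<ge> 2" and few: "card {T \<in> L. card T = 2} < 2 * k"
    and D: "card L \<le> D"
  shows "card F \<le> (2 * k - 1) * ((n - 2 * k - 1) choose (k - 2)) + ((2 * k - 1)\<^sup>2 + D) * n ^ (k - 3)"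
proof -
  let ?a = "(n - 2 * k - 1) choose (k - 2)"
  have finF: "finite F"
    using F finite_subset by (metis finite_atLeastAtMost finite_imp_finite_nsets)
  have above: "card {A \<in> F. T \<subseteq> A} \<le> (n - card T) choose (k - card T)" if T: "T \<in> L" for T
  proof -
    obtain A where "A \<in> F" "T \<subseteq> A" using L(2)[OF T] by blast
    then have "A \<subseteq> {1..n}" "finite A" "card A = k" "T \<subseteq> A" using F by (auto simp: nsets_def)
    then have "T \<subseteq> {1..n}" "card T \<le> k"
      using card_mono by blast+
    then have "card {A \<in> nsets {1..n} k. T \<subseteq> A} = (n - card T) choose (k - card T)"
      using card_nsets_containing_avoiding[of "{1..n}" T "{}" k] by simp
    moreover have "card {A \<in> F. T \<subseteq> A} \<le> card {A \<in> nsets {1..n} k. T \<subseteq> A}"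
      using F by (intro card_mono) (auto simp: finite_imp_finite_nsets)
    ultimately show ?thesis by simp
  qed
  let ?P = "{T \<in> L. card T = 2}" and ?Q = "{T \<in> L. card T \<noteq> 2}"
  have "F \<subseteq> (\<Union>T\<in>L. {A \<in> F. T \<subseteq> A})" using L(3) by blast
  then have "card F \<le> card (\<Union>T\<in>L. {A \<in> F. T \<subseteq> A})"
    using finF L(1) by (intro card_mono) auto
  also have "\<dots> \<le> (\<Sum>T\<in>L. card {A \<in> F. T \<subseteq> A})"
    by (rule card_UN_le[OF L(1)])
  also have "\<dots> = (\<Sum>T\<in>?P. card {A \<in> F. T \<subseteq> A}) + (\<Sum>T\<in>?Q. card {A \<in> F. T \<subseteq> A})"
    using L(1) by (subst sum.union_disjoint[symmetric]) (auto intro!: sum.cong)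
  finally have sum: "card F \<le> (\<Sum>T\<in>?P. card {A \<in> F. T \<subseteq> A}) + (\<Sum>T\<in>?Q. card {A \<in> F. T \<subseteq> A})" .
  have P: "(\<Sum>T\<in>?P. card {A \<in> F. T \<subseteq> A}) \<le> (2 * k - 1) * ((n - 2) choose (k - 2))"
  proof -
    have "(\<Sum>T\<in>?P. card {A \<in> F. T \<subseteq> A}) \<le> (\<Sum>T\<in>?P. (n - 2) choose (k - 2))"
      using above by (intro sum_mono) force
    also have "\<dots> = card ?P * ((n - 2) choose (k - 2))"
      by simp
    also have "\<dots> \<le> (2 * k - 1) * ((n - 2) choose (k - 2))"
      using few by (intro mult_right_mono) auto
    finally show ?thesis .
  qed
  have Q: "(\<Sum>T\<in>?Q. card {A \<in> F. T \<subseteq> A}) \<le> D * n ^ (k - 3)"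
  proof -
    have "card {A \<in> F. T \<subseteq> A} \<le> n ^ (k - 3)" if T: "T \<in> ?Q" for T
    proof -
      have "card {A \<in> F. T \<subseteq> A} \<le> (n - card T) ^ (k - card T)"
        using above[of T] T choose_le_power[of "n - card T" "k - card T"] by auto
      also have "\<dots> \<le> n ^ (k - card T)" by (intro power_mono) auto
      also have "\<dots> \<le> n ^ (k - 3)"
        using two[of T] T n by (intro power_increasing) auto
      finally show ?thesis .
    qed
    then have "(\<Sum>T\<in>?Q. card {A \<in> F. T \<subseteq> A}) \<le> (\<Sum>T\<in>?Q. n ^ (k - 3))"
      by (intro sum_mono)
    also have "\<dots> = card ?Q * n ^ (k - 3)" by simp
    also have "\<dots> \<le> D * n ^ (k - 3)"
      using D L(1) card_mono[of L ?Q] by (intro mult_right_mono) auto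
    finally show ?thesis .
  qed
  \<comment> \<open>Passing to the binomial of \<open>main_term_ge\<close> costs
    \<open>2 * k - 1\<close> Pascal steps.\<close>
  have "(n - 2) choose (k - 2) \<le> ?a + (2 * k - 1) * n ^ (k - 3)"
  proof -
    have eqs: "n - 2 * k - 1 + (2 * k - 1) = n - 2" "k - 2 = Suc (k - 3)"
      using k n by auto
    have "(n - 2) choose (k - 2) \<le> ?a + (2 * k - 1) * (n - 2) ^ (k - 3)"
      using choose_add_Suc_le[of "n - 2 * k - 1" "2 * k - 1" "k - 3"] by (simp only: eqs)
    moreover have "(2 * k - 1) * (n - 2) ^ (k - 3) \<le> (2 * k - 1) * n ^ (k - 3)"
      by (intro mult_left_mono power_mono) auto
    ultimately show ?thesis by linarith
  qed
  then have "(2 * k - 1) * ((n - 2) choose (k - 2)) \<le> (2 * k - 1) * (?a + (2 * k - 1) * n ^ (k - 3))"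
    by (rule mult_left_mono) simp
  then have "card F \<le> (2 * k - 1) * (?a + (2 * k - 1) * n ^ (k - 3)) + D * n ^ (k - 3)"
    using sum P Q by linarith
  then show ?thesis
    by (simp only: power2_eq_square add_mult_distrib add_mult_distrib2 mult.assoc add.assoc)
qed

theorem theorem1p9:
  fixes k :: nat
  assumes "k \<ge> 2"
  shows "\<exists>n0::nat. \<forall>n\<ge>n0. \<forall>F.
           F \<subseteq> nsets {1..n} k \<and> ell F \<ge> 3 \<and> C6_free (with_proj (kneser n k) \<restriction> F) \<longrightarrow>
           real (card F) < main_term n k + 10 ^ 6 * main_term n k powr (3 / 4)"
proof -
  define w where "w = 5 * k"
  \<comment> \<open>\<open>D\<close> bounds the number of kernels. In \<open>E\<close>, the first
    two summands absorb the lower order terms of the pair case, the last one the additive constant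
    of the star case.\<close>
  define D where "D = (\<Sum>j\<le>k. w ^ j)"
  define E where "E = (2 * k - 1)\<^sup>2 + D + (2 + w ^ k)\<^sup>2"
  define n0 where "n0 = 4 * k + 2 + E * (2 * k) ^ (k - 2)"
  have "real (card F) < main_term n k + 10 ^ 6 * main_term n k powr (3 / 4)"
    if n: "n \<ge> n0" and F: "F \<subseteq> nsets {1..n} k" and ell: "ell F \<ge> 3"
      and free: "C6_free (with_proj (kneser n k) \<restriction> F)" for n F
  proof -
    let ?M = "main_term n k" and ?a = "(n - 2 * k - 1) choose (k - 2)"
    have n2: "n > 2 * k" "n \<ge> 4 * k + 2" using n unfolding n0_def by auto
    have M: "?M \<ge> 2 * real k * real ?a"
      using main_term_ge[OF assms n2(1)] .
    have a1: "?a \<ge> 1"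
      using n2 by (simp add: Suc_le_eq zero_less_binomial_iff)
    have M1: "?M \<ge> real ?a" "?M \<ge> 1"
    proof -
      have "1 * real ?a \<le> 2 * real k * real ?a"
        using assms by (intro mult_right_mono) auto
      then show "?M \<ge> real ?a" using M by linarith
      then show "?M \<ge> 1" using a1 by linarith
    qed
    have mem: "finite A \<and> card A = k" if "A \<in> F" for A
      using that F by (auto simp: nsets_def)
    obtain L where L_all: "finite L \<and> (\<forall>T\<in>L. robust w F T) \<and> (\<forall>A\<in>F. \<exists>T\<in>L. T \<subseteq> A) \<and>
        (\<forall>j. card {T \<in> L. card T = j} \<le> w ^ j)"
      using robust_cover[OF mem, of F w] by auto
    have L: "finite L" "\<And>T. T \<in> L \<Longrightarrow> robust w F T" "\<And>A. A \<in> F \<Longrightarrow> \<exists>T\<in>L. T \<subseteq> A"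
      "\<And>j. card {T \<in> L. card T = j} \<le> w ^ j"
      using L_all by blast+
    have below: "\<exists>A\<in>F. T \<subseteq> A" if "T \<in> L" for T
      using robust_subset_member[OF L(2)[OF that]] by metis
    have finT: "finite T" "card T \<le> k" if "T \<in> L" for T
    proof -
      obtain A where A: "A \<in> F" "T \<subseteq> A" using below[OF \<open>T \<in> L\<close>] by blast
      then show "finite T" "card T \<le> k"
        using mem[OF A(1)] finite_subset card_mono by blast+
    qed
    have int: "T \<inter> T' \<noteq> {}" if "T \<in> L" "T' \<in> L" "card T < k" "card T' < k" for T T'
      using robust_intersect[OF free F] that L(2) unfolding w_def by blast
    have large: "E * n ^ (k - 3) < ?a" if "k \<ge> 3"
      using choose_gt_mult_power[OF that n2(2), of E] n n2 unfolding n0_def by simp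
    consider (star) x where "\<forall>T\<in>L. card T < k \<longrightarrow> x \<in> T"
      | (pairs) "\<forall>T\<in>L. card T \<ge> 2" "k \<ge> 3 \<longrightarrow> card {T \<in> L. card T = 2} < 2 * k"
      using kernels_dichotomy[OF assms finT(1) L(1) int] by blast
    then show ?thesis
    proof cases
      case star
      have le: "real (card F) \<le> ?M + 2 + real (w ^ k)"
      proof (rule card_le_of_star_kernels[OF free F ell _ n2(1) L(1,3) L(4)])
        show "x \<in> T" if "T \<in> L" "card T < k" for T using star that by blast
      qed (use assms in simp)
      \<comment> \<open>For \<open>k \<ge> 3\<close> the constant is at most the square root of
        \<open>?M\<close>, by the choice of \<open>E\<close>.\<close>
      have "2 + real (w ^ k) < 10 ^ 6 * ?M powr (3 / 4)"
      proof (cases "k \<ge> 3")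
        case True
        have "E \<le> E * n ^ (k - 3)" using n2 by simp
        then have "(2 + w ^ k)\<^sup>2 \<le> ?a" using large[OF True] unfolding E_def by linarith
        then have "real ((2 + w ^ k)\<^sup>2) \<le> ?M" using M1 by linarith
        then have sq: "(2 + real (w ^ k))\<^sup>2 \<le> ?M" by simp
        have "2 + real (w ^ k) \<le> sqrt ?M"
          using sq by (intro real_le_rsqrt)
        also have "\<dots> = ?M powr (1 / 2)"
          using M1 by (simp add: powr_half_sqrt)
        also have "\<dots> \<le> ?M powr (3 / 4)"
          using M1 by (intro powr_mono) auto
        also have "\<dots> < 10 ^ 6 * ?M powr (3 / 4)"
          using M1 by simp
        finally show ?thesis .
      next
        case False
        then have "k = 2" using assms by simp
        \<comment> \<open>Here \<open>?a = 1\<close> does not grow with \<open>n\<close>, but the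
          constant is only \<open>102\<close>.\<close>
        then have "2 + real (w ^ k) < 10 ^ 6 * 1" unfolding w_def by simp
        also have "\<dots> \<le> 10 ^ 6 * ?M powr (3 / 4)"
          using M1 by (intro mult_left_mono ge_one_powr_ge_zero) auto
        finally show ?thesis .
      qed
      then show ?thesis using le by linarith
    next
      case pairs
      \<comment> \<open>\<open>100\<close> is \<open>w ^ k\<close> for \<open>k = 2\<close>; for
        \<open>k \<ge> 3\<close> only positivity matters.\<close>
      have "(100::real) < 10 ^ 6 * 1" by simp
      also have "\<dots> \<le> 10 ^ 6 * ?M powr (3 / 4)"
        using M1 by (intro mult_left_mono ge_one_powr_ge_zero) auto
      finally have pos: "100 < 10 ^ 6 * ?M powr (3 / 4)" .
      show ?thesis
      proof (cases "k \<ge> 3")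
        case True
        have "L = (\<Union>j\<le>k. {T \<in> L. card T = j})" using finT(2) by auto
        then have "card L \<le> (\<Sum>j\<le>k. card {T \<in> L. card T = j})"
          using card_UN_le[of "{..k}" "\<lambda>j. {T \<in> L. card T = j}"] by simp
        also have "\<dots> \<le> D" unfolding D_def by (intro sum_mono L(4))
        finally have "card L \<le> D" .
        then have "card F \<le> (2 * k - 1) * ?a + ((2 * k - 1)\<^sup>2 + D) * n ^ (k - 3)"
          using card_le_of_few_pairs[OF F True n2(1) L(1) below L(3)] pairs True by simp
        also have "\<dots> \<le> (2 * k - 1) * ?a + E * n ^ (k - 3)"
          unfolding E_def by (intro add_left_mono mult_right_mono) auto
        \<comment> \<open>The error fits into the one copy of \<open>?a\<close> by which
          \<open>2 * k\<close> exceeds \<open>2 * k - 1\<close>.\<close>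
        also have "\<dots> \<le> (2 * k - 1) * ?a + ?a"
          using large[OF True] by simp
        also have "\<dots> = 2 * k * ?a"
          using assms by (simp add: algebra_simps flip: mult_Suc)
        finally have "real (card F) \<le> real (2 * k * ?a)" by (simp only: of_nat_le_iff)
        then have "real (card F) \<le> ?M" using M by simp
        then show ?thesis using pos by linarith
      next
        case False
        then have k2: "k = 2" using assms by simp
        \<comment> \<open>All kernels have full size, so every member is a kernel and the family is
          bounded.\<close>
        have "F \<subseteq> {T \<in> L. card T = k}"
        proof
          fix A assume A: "A \<in> F"
          then obtain T where T: "T \<in> L" "T \<subseteq> A" using L(3) by blast
          then have "T = A"
            using pairs(1) mem[OF A] k2 by (simp add: card_seteq)
          then show "A \<in> {T \<in> L. card T = k}" using T mem[OF A] by simp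
        qed
        then have "card F \<le> card {T \<in> L. card T = k}" using L(1) by (intro card_mono) auto
        also have "\<dots> \<le> w ^ k" by (rule L(4))
        also have "\<dots> = 100" unfolding w_def k2 by simp
        finally have "real (card F) \<le> 100" by simp
        then show ?thesis using pos M1(2) by linarith
      qed
    qed
  qed
  then show ?thesis by blast
qed

end
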